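(* Let $V:\mathbb{R}^m\to\overline{\mathbb{R}}$ be proper, convex and lower semicontinuous and let $\Phi:\mathbb{R}^n\to\mathbb{R}^m$ be a nonlinear, locally Lipschitz continuous mapping. A point $(\bar x,\bar\sigma)\in\mathbb{R}^n\times\mathbb{R}^m$ satisfies the stationarity conditions $$0\in\partial(\bar\sigma\circ\Phi)(\bar x),\qquad 0\in\Phi(\bar x)-\partial V^*(\bar\sigma)$$ for the problem $\min_{x}V(\Phi(x))$ if and only if there exists $\bar y\in\mathbb{R}^m$ such that $(\bar x,\bar y,\bar\sigma)$ satisfies the Lagrange stationarity conditions $$0\in\partial_x\mathcal{L}_c(\bar x,\bar y,\bar\sigma)=\partial(\bar\sigma\circ\Phi)(\bar x),\qquad 0\in\partial_y\mathcal{L}_c(\bar x,\bar y,\bar\sigma)=\partial V(\bar y)-\bar\sigma,\qquad 0=\Phi(\bar x)-\bar y$$ of the constrained problem $\min_{x,y}V(y)$ subject to $\Phi(x)=y$, whose Lagrangian is $\mathcal{L}_c(x,y,\sigma)=V(y)+\langle\sigma,\Phi(x)-y\rangle$.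
   Context: $\overline{\mathbb{R}}=[-\infty,\infty]$. A function is proper if it never takes the value $-\infty$ and is not identically $+\infty$. $V^*(\sigma)=\sup_{y\in\mathbb{R}^m}\{\langle y,\sigma\rangle-V(y)\}$ is the convex conjugate of $V$. The function $\bar\sigma\circ\Phi$ is $x\mapsto\langle\bar\sigma,\Phi(x)\rangle$, and $\partial(\bar\sigma\circ\Phi)$ is its (limiting/general) subdifferential in the sense of Rockafellar–Wets, "Variational Analysis"; for the convex functions $V$, $V^*$, $\partial$ is the convex subdifferential. $\Phi(\bar x)-\partial V^*(\bar\sigma)=\{\Phi(\bar x)-v: v\in\partial V^*(\bar\sigma)\}$ and $\partial V(\bar y)-\bar\sigma=\{s-\bar\sigma: s\in\partial V(\bar y)\}$. *)

theory Defs
  imports "HOL-Analysis.Analysis"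
begin

definition proper_fun :: "('a \<Rightarrow> ereal) \<Rightarrow> bool" where
  "proper_fun f \<longleftrightarrow> (\<forall>x. f x \<noteq> -\<infinity>) \<and> (\<exists>x. f x \<noteq> \<infinity>)"

text \<open>Addition on \<^typ>\<open>ereal\<close> satisfies \<open>\<infinity> + (-\<infinity>) = \<infinity>\<close>, which is the usual
  inf-addition convention for convexity of extended-real-valued functions.\<close>

definition convex_fun :: "('a::real_vector \<Rightarrow> ereal) \<Rightarrow> bool" where
  "convex_fun f \<longleftrightarrow> (\<forall>x y. \<forall>t\<in>{0<..<1::real}.
     f ((1 - t) *\<^sub>R x + t *\<^sub>R y) \<le> ereal (1 - t) * f x + ereal t * f y)"

text \<open>The filter \<open>nhds x\<close> (rather than \<open>at x\<close>) is the convention of Rockafellar and Wets,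
  where the lower limit at a point takes the value at that point into account.\<close>

definition lsc_fun :: "('a::topological_space \<Rightarrow> ereal) \<Rightarrow> bool" where
  "lsc_fun f \<longleftrightarrow> (\<forall>x. f x \<le> Liminf (nhds x) f)"

definition locally_lipschitz :: "('a::metric_space \<Rightarrow> 'b::metric_space) \<Rightarrow> bool" where
  "locally_lipschitz F \<longleftrightarrow> (\<forall>x. \<exists>u>0. \<exists>L. L-lipschitz_on (ball x u) F)"

definition conjugate :: "('a::real_inner \<Rightarrow> ereal) \<Rightarrow> 'a \<Rightarrow> ereal" where
  "conjugate f s = (SUP y. ereal (y \<bullet> s) - f y)"

text \<open>All subdifferentials are empty at points where the function is not finite.\<close>

definition convex_subdiff :: "('a::real_inner \<Rightarrow> ereal) \<Rightarrow> 'a \<Rightarrow> 'a set" where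
  "convex_subdiff f x = {v. \<bar>f x\<bar> \<noteq> \<infinity> \<and> (\<forall>z. f x + ereal (v \<bullet> (z - x)) \<le> f z)}"

text \<open>Regular (Frechet) subgradients, defined by
  \<open>f z \<ge> f x + v \<bullet> (z - x) + o(norm (z - x))\<close>, the one-sided little-o being written
  as a lower limit.\<close>

definition regular_subdiff :: "('a::real_inner \<Rightarrow> ereal) \<Rightarrow> 'a \<Rightarrow> 'a set" where
  "regular_subdiff f x = {v. \<bar>f x\<bar> \<noteq> \<infinity> \<and>
     0 \<le> Liminf (at x) (\<lambda>z. (f z - f x - ereal (v \<bullet> (z - x))) / ereal (norm (z - x)))}"

text \<open>General (limiting) subgradients in the sense of Rockafellar and Wets: limits of regular
  subgradients along \<open>f\<close>-attentive convergent sequences.\<close>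

definition limiting_subdiff :: "('a::real_inner \<Rightarrow> ereal) \<Rightarrow> 'a \<Rightarrow> 'a set" where
  "limiting_subdiff f x = {v. \<bar>f x\<bar> \<noteq> \<infinity> \<and>
     (\<exists>xs vs. xs \<longlonglongrightarrow> x \<and> (\<lambda>k. f (xs k)) \<longlonglongrightarrow> f x \<and>
        (\<forall>k::nat. vs k \<in> regular_subdiff f (xs k)) \<and> vs \<longlonglongrightarrow> v)}"

definition scalarization :: "'b::real_inner \<Rightarrow> ('a \<Rightarrow> 'b) \<Rightarrow> 'a \<Rightarrow> ereal" where
  "scalarization s F = (\<lambda>x. ereal (s \<bullet> F x))"

definition stationary ::
  "('b::real_inner \<Rightarrow> ereal) \<Rightarrow> ('a::real_inner \<Rightarrow> 'b) \<Rightarrow> 'a \<Rightarrow> 'b \<Rightarrow> bool" where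
  "stationary V F x s \<longleftrightarrow>
     0 \<in> limiting_subdiff (scalarization s F) x \<and>
     0 \<in> {F x - v | v. v \<in> convex_subdiff (conjugate V) s}"

definition lagrangian ::
  "('b::real_inner \<Rightarrow> ereal) \<Rightarrow> ('a \<Rightarrow> 'b) \<Rightarrow> 'a \<Rightarrow> 'b \<Rightarrow> 'b \<Rightarrow> ereal" where
  "lagrangian V F x y s = V y + ereal (s \<bullet> (F x - y))"

text \<open>Partial subdifferentials of the Lagrangian: the general subdifferential with respect to one
  block of variables, the others being fixed.\<close>

definition lagrangian_subdiff_x ::
  "('b::real_inner \<Rightarrow> ereal) \<Rightarrow> ('a::real_inner \<Rightarrow> 'b) \<Rightarrow> 'a \<Rightarrow> 'b \<Rightarrow> 'b \<Rightarrow> 'a set" where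
  "lagrangian_subdiff_x V F x y s = limiting_subdiff (\<lambda>x'. lagrangian V F x' y s) x"

definition lagrangian_subdiff_y ::
  "('b::real_inner \<Rightarrow> ereal) \<Rightarrow> ('a \<Rightarrow> 'b) \<Rightarrow> 'a \<Rightarrow> 'b \<Rightarrow> 'b \<Rightarrow> 'b set" where
  "lagrangian_subdiff_y V F x y s = limiting_subdiff (\<lambda>y'. lagrangian V F x y' s) y"

definition lagrange_stationary ::
  "('b::real_inner \<Rightarrow> ereal) \<Rightarrow> ('a::real_inner \<Rightarrow> 'b) \<Rightarrow> 'a \<Rightarrow> 'b \<Rightarrow> 'b \<Rightarrow> bool" where
  "lagrange_stationary V F x y s \<longleftrightarrow>
     0 \<in> lagrangian_subdiff_x V F x y s \<and>
     0 \<in> lagrangian_subdiff_y V F x y s \<and>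
     0 = F x - y"

end

theory Submission
  imports Defs
begin

text \<open>The only step that is not formal is the inversion rule
  \<open>\<sigma> \<in> \<partial>V(y) \<longleftrightarrow> y \<in> \<partial>V\<^sup>*(\<sigma>)\<close>. From left to right, it is the equality case of the
  Fenchel-Young inequality. Conversely, let \<open>c = V\<^sup>*(\<sigma>)\<close> and suppose that \<open>V(y)\<close> exceeds
  \<open>a = \<langle>y,\<sigma>\<rangle> - c\<close>. A hyperplane \<open>(p,q)\<close> with \<open>q \<ge> 0\<close> strictly separates \<open>(y,a)\<close> from the closed
  convex epigraph of \<open>V\<close>. Adding the affine minorant \<open>\<langle>\<sigma>,\<cdot>\<rangle> - c\<close> of \<open>V\<close> to it makes the
  hyperplane non-vertical, and its slope \<open>(\<sigma> - p) / (1 + q)\<close> then violates the subgradient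
  inequality of \<open>V\<^sup>*\<close> at \<open>\<sigma>\<close>.\<close>

section \<open>Convex, regular and limiting subgradients\<close>

lemma convex_subdiff_subset_limiting_subdiff:
  "convex_subdiff f x \<subseteq> limiting_subdiff f x"
proof
  fix v assume v: "v \<in> convex_subdiff f x"
  then have fin: "\<bar>f x\<bar> \<noteq> \<infinity>" and le: "\<And>z. f x + ereal (v \<bullet> (z - x)) \<le> f z"
    by (auto simp: convex_subdiff_def)
  obtain a where a: "f x = ereal a"
    using fin by (cases "f x") auto
  have nonneg: "0 \<le> (f z - f x - ereal (v \<bullet> (z - x))) / ereal (norm (z - x))" if "z \<noteq> x" for z
    using le[of z] a that by (cases "f z") auto
  have "0 \<le> Liminf (at x) (\<lambda>z. (f z - f x - ereal (v \<bullet> (z - x))) / ereal (norm (z - x)))"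
    by (intro Liminf_bounded) (auto simp: eventually_at_filter nonneg)
  with fin have "v \<in> regular_subdiff f x"
    by (simp add: regular_subdiff_def)
  with fin show "v \<in> limiting_subdiff f x"
    unfolding limiting_subdiff_def
    by (intro CollectI conjI exI[of _ "\<lambda>_. x"] exI[of _ "\<lambda>_. v"]) auto
qed

text \<open>Convexity bounds the difference quotient along the segment from \<open>x\<close> to
  \<open>z\<close> by its value at \<open>z\<close>. A lower limit that is nonnegative at
  \<open>x\<close> therefore makes the quotient at \<open>z\<close> nonnegative, which is the global
  inequality.\<close>

lemma regular_subdiff_subset_convex_subdiff:
  assumes "convex_fun f" and "\<And>z. f z \<noteq> -\<infinity>"
  shows "regular_subdiff f x \<subseteq> convex_subdiff f x"
proof
  fix v assume v: "v \<in> regular_subdiff f x"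
  define Q where "Q = (\<lambda>z. (f z - f x - ereal (v \<bullet> (z - x))) / ereal (norm (z - x)))"
  have fin: "\<bar>f x\<bar> \<noteq> \<infinity>" and lim: "0 \<le> Liminf (at x) Q"
    using v by (auto simp: regular_subdiff_def Q_def)
  obtain a where a: "f x = ereal a"
    using fin by (cases "f x") auto
  have "f x + ereal (v \<bullet> (z - x)) \<le> f z" for z
  proof (cases "z = x \<or> f z = \<infinity>")
    case True
    then show ?thesis by auto
  next
    case False
    then have ne: "z \<noteq> x" by simp
    obtain b where b: "f z = ereal b"
      using False assms(2)[of z] by (cases "f z") auto
    define w where "w = (\<lambda>t. x + t *\<^sub>R (z - x))"
    \<comment> \<open>\<open>B\<close> is the real value of \<open>Q z\<close>, the bound for the
      quotients along the segment.\<close>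
    define B where "B = (b - a - v \<bullet> (z - x)) / norm (z - x)"
    have quot: "Q (w t) \<le> ereal B" if t: "0 < t" "t < 1" for t
    proof -
      have "w t = (1 - t) *\<^sub>R x + t *\<^sub>R z"
        by (simp add: w_def algebra_simps)
      then have "f (w t) \<le> ereal (1 - t) * f x + ereal t * f z"
        using assms(1) t by (auto simp: convex_fun_def)
      then have le: "f (w t) \<le> ereal ((1 - t) * a + t * b)"
        by (simp add: a b)
      obtain c where c: "f (w t) = ereal c"
        using le assms(2)[of "w t"] by (cases "f (w t)") auto
      have "c \<le> (1 - t) * a + t * b"
        using le by (simp add: c)
      then have "c - a - v \<bullet> (w t - x) \<le> t * (b - a - v \<bullet> (z - x))"
        by (simp add: w_def algebra_simps)
      then have "(c - a - v \<bullet> (w t - x)) / norm (w t - x)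
          \<le> t * (b - a - v \<bullet> (z - x)) / norm (w t - x)"
        by (intro divide_right_mono) auto
      also have "\<dots> = B"
        using t by (simp add: B_def w_def)
      finally show ?thesis
        unfolding Q_def c a using t ne by (simp add: w_def)
    qed
    \<comment> \<open>This pulls eventual statements near \<open>x\<close> back to small positive
      \<open>t\<close>, where the bound by \<open>B\<close> applies.\<close>
    have tendsto: "filterlim w (at x) (at_right 0)"
    proof (rule filterlim_atI)
      have "(w \<longlongrightarrow> x + 0 *\<^sub>R (z - x)) (at_right 0)"
        unfolding w_def by (intro tendsto_intros)
      then show "(w \<longlongrightarrow> x) (at_right 0)" by simp
      show "\<forall>\<^sub>F t in at_right 0. w t \<noteq> x"
        using ne by (auto simp: w_def eventually_at_filter)
    qed
    have "0 \<le> B"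
    proof (rule ccontr)
      assume "\<not> 0 \<le> B"
      then have "ereal B < Liminf (at x) Q"
        using lim by (metis ereal_less(5) linorder_not_le order_less_le_trans ereal_less_eq(5))
      then have "\<forall>\<^sub>F u in at x. ereal B < Q u"
        by (rule less_LiminfD)
      then have "\<forall>\<^sub>F t in at_right 0. ereal B < Q (w t)"
        using tendsto unfolding filterlim_iff by blast
      moreover have "\<forall>\<^sub>F t in at_right 0. t \<in> {0<..<1::real}"
        by (rule eventually_at_right_real) simp
      ultimately have "\<forall>\<^sub>F t in at_right (0::real). False"
        by eventually_elim (use quot in \<open>force simp: not_less\<close>)
      then show False by simp
    qed
    then show ?thesis
      using ne by (simp add: B_def a b zero_le_divide_iff)
  qed
  with fin show "v \<in> convex_subdiff f x"
    by (simp add: convex_subdiff_def)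
qed

text \<open>Lower semicontinuity is not needed for the closedness of the graph of the convex
  subdifferential, because the sequences in \<^const>\<open>limiting_subdiff\<close> are \<open>f\<close>-attentive.\<close>

lemma limiting_subdiff_eq_convex_subdiff:
  assumes "convex_fun f" and "\<And>z. f z \<noteq> -\<infinity>"
  shows "limiting_subdiff f x = convex_subdiff f x"
proof
  show "limiting_subdiff f x \<subseteq> convex_subdiff f x"
  proof
    fix v assume "v \<in> limiting_subdiff f x"
    then obtain xs vs where fin: "\<bar>f x\<bar> \<noteq> \<infinity>" and xs: "xs \<longlonglongrightarrow> x"
      and fxs: "(\<lambda>k. f (xs k)) \<longlonglongrightarrow> f x" and vs: "vs \<longlonglongrightarrow> v"
      and reg: "\<And>k::nat. vs k \<in> regular_subdiff f (xs k)"
      by (auto simp: limiting_subdiff_def)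
    have le: "f (xs k) + ereal (vs k \<bullet> (z - xs k)) \<le> f z" for k z
      using regular_subdiff_subset_convex_subdiff[OF assms] reg[of k]
      by (auto simp: convex_subdiff_def)
    have "f x + ereal (v \<bullet> (z - x)) \<le> f z" for z
    proof (rule LIMSEQ_le_const2)
      show "(\<lambda>k. f (xs k) + ereal (vs k \<bullet> (z - xs k))) \<longlonglongrightarrow> f x + ereal (v \<bullet> (z - x))"
        using fin by (intro tendsto_add_ereal fxs tendsto_intros xs vs) auto
    qed (use le in blast)
    with fin show "v \<in> convex_subdiff f x"
      by (simp add: convex_subdiff_def)
  qed
qed (rule convex_subdiff_subset_limiting_subdiff)

section \<open>Constant and affine perturbations\<close>

lemma regular_subdiff_add_const:
  "regular_subdiff (\<lambda>z. f z + ereal c) x = regular_subdiff f x"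
proof -
  \<comment> \<open>The cancellation requires \<open>f x\<close> to be finite; otherwise both
    subdifferentials are empty.\<close>
  have "f z + ereal c - (f x + ereal c) = f z - f x" if "\<bar>f x\<bar> \<noteq> \<infinity>" for z
    using that by (cases "f z"; cases "f x") auto
  then show ?thesis
    by (cases "\<bar>f x\<bar> = \<infinity>") (auto simp: regular_subdiff_def)
qed

text \<open>For fixed \<open>y\<close> with \<open>V y\<close> finite, the Lagrangian is the
  scalarization plus a constant in \<open>x\<close>; this lemma removes that constant.\<close>

lemma limiting_subdiff_add_const:
  "limiting_subdiff (\<lambda>z. f z + ereal c) x = limiting_subdiff f x"
proof -
  have "(\<lambda>k. f (xs k) + ereal c) \<longlonglongrightarrow> f x + ereal c \<longleftrightarrow> (\<lambda>k. f (xs k)) \<longlonglongrightarrow> f x" for xs :: "nat \<Rightarrow> _"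
  proof
    assume "(\<lambda>k. f (xs k) + ereal c) \<longlonglongrightarrow> f x + ereal c"
    then have "(\<lambda>k. f (xs k) + ereal c + ereal (- c)) \<longlonglongrightarrow> f x + ereal c + ereal (- c)"
      by (rule tendsto_add_ereal_general[OF _ _ tendsto_const, rotated]) auto
    moreover have "u + ereal c + ereal (- c) = u" for u
      by (cases u) auto
    ultimately show "(\<lambda>k. f (xs k)) \<longlonglongrightarrow> f x"
      by simp
  qed (intro tendsto_add_ereal_general tendsto_const, auto)
  moreover have "\<bar>f x + ereal c\<bar> \<noteq> \<infinity> \<longleftrightarrow> \<bar>f x\<bar> \<noteq> \<infinity>"
    by (cases "f x") auto
  ultimately show ?thesis
    by (simp add: limiting_subdiff_def regular_subdiff_add_const)
qed

lemma convex_fun_add_inner: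
  fixes f :: "'a::real_inner \<Rightarrow> ereal"
  assumes "convex_fun f" and "\<And>z. f z \<noteq> -\<infinity>"
  shows "convex_fun (\<lambda>z. f z + ereal (s \<bullet> (u - z)))"
  unfolding convex_fun_def
proof (intro allI ballI)
  fix y z :: 'a and t :: real
  assume t: "t \<in> {0<..<1}"
  have le: "f ((1 - t) *\<^sub>R y + t *\<^sub>R z) \<le> ereal (1 - t) * f y + ereal t * f z"
    using assms(1) t by (auto simp: convex_fun_def)
  have inner: "s \<bullet> (u - ((1 - t) *\<^sub>R y + t *\<^sub>R z)) = (1 - t) * (s \<bullet> (u - y)) + t * (s \<bullet> (u - z))"
    by (simp add: algebra_simps)
  show "f ((1 - t) *\<^sub>R y + t *\<^sub>R z) + ereal (s \<bullet> (u - ((1 - t) *\<^sub>R y + t *\<^sub>R z)))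
      \<le> ereal (1 - t) * (f y + ereal (s \<bullet> (u - y))) + ereal t * (f z + ereal (s \<bullet> (u - z)))"
    unfolding inner using le t assms(2)[of y] assms(2)[of z]
    by (cases "f y"; cases "f z"; cases "f ((1 - t) *\<^sub>R y + t *\<^sub>R z)") (auto simp: algebra_simps)
qed

text \<open>The affine term has slope \<open>- s\<close>, so subgradients shift by
  \<open>- s\<close>. The Lagrangian has this form as a function of \<open>y\<close>, with
  \<open>u\<close> equal to the value of the mapping at \<open>x\<close>.\<close>

lemma convex_subdiff_add_inner:
  fixes f :: "'a::real_inner \<Rightarrow> ereal"
  shows "convex_subdiff (\<lambda>z. f z + ereal (s \<bullet> (u - z))) y = {v - s | v. v \<in> convex_subdiff f y}"
proof -
  have iff: "w \<in> convex_subdiff (\<lambda>z. f z + ereal (s \<bullet> (u - z))) y \<longleftrightarrow> w + s \<in> convex_subdiff f y" for w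
  proof (cases "f y")
    case (real a)
    have "f y + ereal (s \<bullet> (u - y)) + ereal (w \<bullet> (z - y)) \<le> f z + ereal (s \<bullet> (u - z))
        \<longleftrightarrow> f y + ereal ((w + s) \<bullet> (z - y)) \<le> f z" for z
      using real by (cases "f z") (auto simp: algebra_simps)
    with real show ?thesis
      by (simp add: convex_subdiff_def)
  qed (simp_all add: convex_subdiff_def)
  show ?thesis
  proof (rule set_eqI)
    fix w
    show "w \<in> convex_subdiff (\<lambda>z. f z + ereal (s \<bullet> (u - z))) y
        \<longleftrightarrow> w \<in> {v - s | v. v \<in> convex_subdiff f y}"
      unfolding iff by (auto intro: exI[of _ "w + s"])
  qed
qed

section \<open>Epigraphs, conjugation and the inversion rule\<close>

text \<open>If the limit of points of the epigraph lay below the graph, a level \<open>d\<close>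
  strictly in between would eventually exceed their heights and, by lower semicontinuity, stay below
  the values of \<open>f\<close>.\<close>

lemma closed_epigraph:
  fixes f :: "'a::metric_space \<Rightarrow> ereal"
  assumes "lsc_fun f"
  shows "closed {(z, r). f z \<le> ereal r}"
proof (unfold closed_sequential_limits, intro allI impI, elim conjE)
  fix p :: "nat \<Rightarrow> 'a \<times> real" and l
  assume p: "\<forall>n. p n \<in> {(z, r). f z \<le> ereal r}" and lim: "p \<longlonglongrightarrow> l"
  have "f (fst l) \<le> ereal (snd l)"
  proof (rule ccontr)
    assume "\<not> f (fst l) \<le> ereal (snd l)"
    then obtain d where d: "ereal (snd l) < ereal d" "ereal d < f (fst l)"
      by (metis ereal_dense2 not_le)
    then have "ereal d < Liminf (nhds (fst l)) f"
      using assms by (auto simp: lsc_fun_def intro: less_le_trans)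
    then have "\<forall>\<^sub>F w in nhds (fst l). ereal d < f w"
      by (rule less_LiminfD)
    then have "\<forall>\<^sub>F n in sequentially. ereal d < f (fst (p n))"
      using tendsto_fst[OF lim] unfolding filterlim_iff by blast
    moreover have "\<forall>\<^sub>F n in sequentially. snd (p n) < d"
      using tendsto_snd[OF lim] d(1) by (auto intro: order_tendstoD)
    ultimately have "\<forall>\<^sub>F n in sequentially. False"
    proof eventually_elim
      case (elim n)
      have "f (fst (p n)) \<le> ereal (snd (p n))"
        using p by (auto simp: case_prod_beta)
      also have "\<dots> < ereal d"
        using elim by simp
      finally show False
        using elim by simp
    qed
    then show False by simp
  qed
  then show "l \<in> {(z, r). f z \<le> ereal r}"
    by (simp add: case_prod_beta)
qed

lemma convex_epigraph:
  assumes "convex_fun f"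
  shows "convex {(z, r). f z \<le> ereal r}"
proof (subst convex_alt, clarsimp)
  fix y :: 'a and r z r' and t :: real
  assume le: "f y \<le> ereal r" "f z \<le> ereal r'" and t: "0 \<le> t" "t \<le> 1"
  show "f ((1 - t) *\<^sub>R y + t *\<^sub>R z) \<le> ereal ((1 - t) * r + t * r')"
  \<comment> \<open>\<open>convex_fun\<close> speaks only of \<open>t\<close> strictly between 0 and
    1, so the end points are separate.\<close>
  proof (cases "t = 0 \<or> t = 1")
    case True
    with le show ?thesis by auto
  next
    case False
    then have "f ((1 - t) *\<^sub>R y + t *\<^sub>R z) \<le> ereal (1 - t) * f y + ereal t * f z"
      using assms t by (auto simp: convex_fun_def)
    also have "\<dots> \<le> ereal (1 - t) * ereal r + ereal t * ereal r'"
      using le t by (intro add_mono ereal_mult_left_mono) auto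
    finally show ?thesis by simp
  qed
qed

lemma Fenchel_Young:
  "ereal (y \<bullet> s) - f y \<le> conjugate f s"
  unfolding conjugate_def by (rule SUP_upper) simp

lemma convex_subdiff_conjugateI:
  assumes "s \<in> convex_subdiff f y"
  shows "y \<in> convex_subdiff (conjugate f) s"
proof -
  have fin: "\<bar>f y\<bar> \<noteq> \<infinity>" and le: "\<And>z. f y + ereal (s \<bullet> (z - y)) \<le> f z"
    using assms by (auto simp: convex_subdiff_def)
  obtain a where a: "f y = ereal a"
    using fin by (cases "f y") auto
  have "conjugate f s \<le> ereal (y \<bullet> s - a)"
    unfolding conjugate_def
  proof (rule SUP_least)
    fix z
    show "ereal (z \<bullet> s) - f z \<le> ereal (y \<bullet> s - a)"
      using le[of z] a by (cases "f z") (auto simp: algebra_simps inner_commute)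
  qed
  then have eq: "conjugate f s = ereal (y \<bullet> s - a)"
    using Fenchel_Young[of y s f] a by (simp add: order.antisym)
  \<comment> \<open>With the supremum attained at \<open>y\<close>, the Fenchel-Young inequality at
    \<open>s'\<close> is already the subgradient inequality.\<close>
  have "conjugate f s + ereal (y \<bullet> (s' - s)) \<le> conjugate f s'" for s'
    using Fenchel_Young[of y s' f] a eq by (simp add: algebra_simps)
  with eq show ?thesis
    by (simp add: convex_subdiff_def)
qed

lemma convex_subdiff_conjugateD:
  fixes f :: "'a::euclidean_space \<Rightarrow> ereal"
  assumes proper: "proper_fun f" and conv: "convex_fun f" and lsc: "lsc_fun f"
    and y: "y \<in> convex_subdiff (conjugate f) s"
  shows "s \<in> convex_subdiff f y"
proof -
  have ninf: "f z \<noteq> -\<infinity>" for z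
    using proper by (simp add: proper_fun_def)
  have fin: "\<bar>conjugate f s\<bar> \<noteq> \<infinity>"
    and sub: "\<And>s'. conjugate f s + ereal (y \<bullet> (s' - s)) \<le> conjugate f s'"
    using y by (auto simp: convex_subdiff_def)
  obtain c where c: "conjugate f s = ereal c"
    using fin by (cases "conjugate f s") auto
  have minor: "z \<bullet> s - c \<le> r" if "f z \<le> ereal r" for z r
    using Fenchel_Young[of z s f] c that by (cases "f z") auto
  define a where "a = y \<bullet> s - c"
  have fy: "f y \<le> ereal a"
  proof (rule ccontr)
    assume "\<not> f y \<le> ereal a"
    then have "(y, a) \<notin> {(z, r). f z \<le> ereal r}" by simp
    then obtain h b where h: "h \<bullet> (y, a) < b" and epi: "\<forall>w\<in>{(z, r). f z \<le> ereal r}. b < h \<bullet> w"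
      using separating_hyperplane_closed_point convex_epigraph[OF conv] closed_epigraph[OF lsc]
      by blast
    obtain p q where pq: "h = (p, q)" by fastforce
    have below: "p \<bullet> y + q * a < b"
      using h by (simp add: pq)
    have above: "b < p \<bullet> z + q * r" if "f z \<le> ereal r" for z r
      using epi that by (auto simp: pq)
    have "0 \<le> q"
    proof (rule ccontr)
      assume q: "\<not> 0 \<le> q"
      obtain z0 where "f z0 \<noteq> \<infinity>"
        using proper by (auto simp: proper_fun_def)
      then obtain r0 where r0: "f z0 = ereal r0"
        using ninf[of z0] by (cases "f z0") auto
      \<comment> \<open>For negative \<open>q\<close>, moving up the vertical ray over
        \<open>z0\<close> to this height leaves the half-space that contains the epigraph.\<close>
      define r where "r = max r0 ((b - p \<bullet> z0) / q)"
      have "b < p \<bullet> z0 + q * r"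
        by (rule above) (simp add: r0 r_def)
      moreover have "q * r \<le> q * ((b - p \<bullet> z0) / q)"
        using q by (intro mult_left_mono_neg) (auto simp: r_def)
      ultimately show False
        using q by simp
    qed
    \<comment> \<open>Adding \<open>above\<close> and \<open>minor\<close> gives
      \<open>(1 + q) * r > z \<bullet> s - p \<bullet> z + b - c\<close> on the epigraph. Division
      by \<open>1 + q\<close>, which is positive even for \<open>q = 0\<close>, yields an affine
      minorant of \<open>f\<close> with slope \<open>s'\<close>.\<close>
    define s' where "s' = (1 / (1 + q)) *\<^sub>R (s - p)"
    have s': "z \<bullet> s' = (z \<bullet> s - p \<bullet> z) / (1 + q)" for z
      by (simp add: s'_def inner_diff_right inner_commute)
    have "conjugate f s' \<le> ereal ((c - b) / (1 + q))"
      unfolding conjugate_def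
    proof (rule SUP_least)
      fix z
      show "ereal (z \<bullet> s') - f z \<le> ereal ((c - b) / (1 + q))"
      proof (cases "f z")
        case (real r)
        then have "z \<bullet> s - p \<bullet> z - (1 + q) * r \<le> c - b"
          using minor[of z r] above[of z r] by (simp add: algebra_simps)
        then have "(z \<bullet> s - p \<bullet> z - (1 + q) * r) / (1 + q) \<le> (c - b) / (1 + q)"
          using \<open>0 \<le> q\<close> by (intro divide_right_mono) auto
        with real \<open>0 \<le> q\<close> show ?thesis
          by (simp add: s' diff_divide_distrib)
      qed (use ninf[of z] in auto)
    qed
    with sub[of s'] have "c + y \<bullet> (s' - s) \<le> (c - b) / (1 + q)"
      unfolding c by (metis ereal_less_eq(3) order_trans plus_ereal.simps(1))
    then have "y \<bullet> s' - a \<le> (c - b) / (1 + q)"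
      by (simp add: a_def inner_diff_right)
    then have "(1 + q) * (y \<bullet> s' - a) \<le> c - b"
      using \<open>0 \<le> q\<close> by (simp add: pos_le_divide_eq mult.commute)
    moreover have "(1 + q) * (y \<bullet> s') = y \<bullet> s - p \<bullet> y"
      using \<open>0 \<le> q\<close> by (simp add: s')
    \<comment> \<open>Since \<open>c = y \<bullet> s - a\<close>, this rearranges to
      \<open>b \<le> p \<bullet> y + q * a\<close>, contrary to \<open>below\<close>.\<close>
    ultimately have "y \<bullet> s - p \<bullet> y - (1 + q) * a \<le> c - b"
      by (simp add: right_diff_distrib)
    with below show False
      by (simp add: a_def algebra_simps)
  qed
  obtain d where d: "f y = ereal d" "d \<le> a"
    using fy ninf[of y] by (cases "f y") auto
  \<comment> \<open>The minorant equals \<open>a\<close> at \<open>y\<close> and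
    \<open>f y \<le> a\<close>, so \<open>f\<close> lies above the line of slope \<open>s\<close>
    through its own value at \<open>y\<close>.\<close>
  have "f y + ereal (s \<bullet> (z - y)) \<le> f z" for z
  proof (cases "f z")
    case (real r)
    then show ?thesis
      using minor[of z r] d by (simp add: a_def algebra_simps inner_commute)
  qed (use ninf[of z] in auto)
  with d show ?thesis
    by (simp add: convex_subdiff_def)
qed

text \<open>The formula for the \<open>x\<close>-subdifferential is restricted to finite
  \<open>V y\<close>: for \<open>V y = \<infinity>\<close> the Lagrangian is constantly infinite in
  \<open>x\<close> and its subdifferential is empty, while that of the scalarization need not be. In
  the \<open>y\<close>-formula both sides are then empty.\<close>

theorem theorem4:
  fixes V :: "real ^ 'm \<Rightarrow> ereal"
    and \<Phi> :: "real ^ 'n \<Rightarrow> real ^ 'm"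
    and x :: "real ^ 'n"
    and \<sigma> :: "real ^ 'm"
  assumes "proper_fun V" and "convex_fun V" and "lsc_fun V"
    and "locally_lipschitz \<Phi>"
  shows "(stationary V \<Phi> x \<sigma> \<longleftrightarrow> (\<exists>y. lagrange_stationary V \<Phi> x y \<sigma>)) \<and>
    (\<forall>y. V y \<noteq> \<infinity> \<longrightarrow>
       lagrangian_subdiff_x V \<Phi> x y \<sigma> = limiting_subdiff (scalarization \<sigma> \<Phi>) x) \<and>
    (\<forall>y. lagrangian_subdiff_y V \<Phi> x y \<sigma> = {s - \<sigma> | s. s \<in> convex_subdiff V y})"
proof -
  have ninf: "V z \<noteq> -\<infinity>" for z
    using assms(1) by (simp add: proper_fun_def)
  have sub_x: "lagrangian_subdiff_x V \<Phi> x y \<sigma> = limiting_subdiff (scalarization \<sigma> \<Phi>) x"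
    if "V y \<noteq> \<infinity>" for y
  proof -
    obtain a where "V y = ereal a"
      using \<open>V y \<noteq> \<infinity>\<close> ninf[of y] by (cases "V y") auto
    then have "(\<lambda>x'. lagrangian V \<Phi> x' y \<sigma>) = (\<lambda>x'. scalarization \<sigma> \<Phi> x' + ereal (a - \<sigma> \<bullet> y))"
      by (simp add: lagrangian_def scalarization_def inner_diff_right algebra_simps)
    then show ?thesis
      by (simp add: lagrangian_subdiff_x_def limiting_subdiff_add_const)
  qed
  \<comment> \<open>The affine term keeps the function of \<open>y\<close> convex and above
    \<open>-\<infinity>\<close>, so its limiting subdifferential is the convex one.\<close>
  have sub_y: "lagrangian_subdiff_y V \<Phi> x y \<sigma> = {s - \<sigma> | s. s \<in> convex_subdiff V y}" for y
    unfolding lagrangian_subdiff_y_def lagrangian_def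
    using convex_fun_add_inner[OF assms(2) ninf] ninf
    by (simp add: limiting_subdiff_eq_convex_subdiff convex_subdiff_add_inner)
  have inversion: "\<Phi> x \<in> convex_subdiff (conjugate V) \<sigma> \<longleftrightarrow> \<sigma> \<in> convex_subdiff V (\<Phi> x)"
    using convex_subdiff_conjugateI convex_subdiff_conjugateD[OF assms(1-3)] by blast
  have "stationary V \<Phi> x \<sigma> \<longleftrightarrow>
      0 \<in> limiting_subdiff (scalarization \<sigma> \<Phi>) x \<and> \<sigma> \<in> convex_subdiff V (\<Phi> x)"
    by (auto simp: stationary_def inversion[symmetric])
  also have "\<dots> \<longleftrightarrow> lagrange_stationary V \<Phi> x (\<Phi> x) \<sigma>"
  proof -
    \<comment> \<open>Convex subgradients exist only at finite values, so either side makes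
      \<open>sub_x\<close> applicable at \<open>\<Phi> x\<close>.\<close>
    have "V (\<Phi> x) \<noteq> \<infinity>" if "\<sigma> \<in> convex_subdiff V (\<Phi> x)"
      using that by (auto simp: convex_subdiff_def)
    then show ?thesis
      using sub_x[of "\<Phi> x"] by (auto simp: lagrange_stationary_def sub_y)
  qed
  \<comment> \<open>The constraint leaves \<open>\<Phi> x\<close> as the only candidate for
    \<open>y\<close>.\<close>
  also have "\<dots> \<longleftrightarrow> (\<exists>y. lagrange_stationary V \<Phi> x y \<sigma>)"
    by (auto simp: lagrange_stationary_def)
  finally show ?thesis
    using sub_x sub_y by blast
qed

end
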